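(* Let $n\ge7$ and let $W_n$ be the complex (Witt) Lie algebra with basis $(e_1,\ldots,e_n)$ and Lie brackets $$[e_1,e_j]=e_{j+1}\quad(2\le j\le n-1),$$ $$[e_i,e_j]=\frac{6(j-i)}{j(j-1)\binom{j+i-2}{i-2}}\,e_{i+j}\quad\Bigl(2\le i\le\tfrac{n-1}{2},\ i+1\le j\le n-i\Bigr)$$ (all other brackets of basis vectors not obtained by skew-symmetry being zero). Every CPA-structure on $W_n$ is given by $$e_1\cdot e_1=\alpha e_{n-2}+\beta e_{n-1}+\gamma e_n,\quad e_1\cdot e_2=\frac{6(n-4)}{(n-2)(n-3)}\,\alpha e_{n-1}+\delta e_n,\quad e_2\cdot e_2=\varepsilon e_n$$ for some parameters $\alpha,\beta,\gamma,\delta,\varepsilon\in\mathbb{C}$.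
   Context: A commutative post-Lie algebra structure (CPA-structure) on a Lie algebra $\mathfrak{g}=(V,[\,,])$ is a bilinear product $x\cdot y$ on $V$ such that for all $x,y,z\in V$: $x\cdot y=y\cdot x$; $[x,y]\cdot z=x\cdot(y\cdot z)-y\cdot(x\cdot z)$; $x\cdot[y,z]=[x\cdot y,z]+[y,x\cdot z]$. Products are listed only for $e_i\cdot e_j$ with $i\le j$; all products $e_i\cdot e_j$, $i\le j$, not listed are zero, and those with $i>j$ are determined by commutativity. *)

theory Defs
  imports Complex_Main
begin

locale lie_algebra = vector_space scale
  for scale :: "'k::field \<Rightarrow> 'v::ab_group_add \<Rightarrow> 'v" +
  fixes bracket :: "'v \<Rightarrow> 'v \<Rightarrow> 'v"
  assumes linear_bracket_right: "Vector_Spaces.linear scale scale (\<lambda>y. bracket x y)"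
    and linear_bracket_left: "Vector_Spaces.linear scale scale (\<lambda>x. bracket x y)"
    and bracket_self: "bracket x x = 0"
    and jacobi: "bracket x (bracket y z) + bracket y (bracket z x) + bracket z (bracket x y) = 0"

text \<open>Commutative post-Lie algebra structures (CPA-structures).\<close>

locale cpa_structure = lie_algebra scale bracket
  for scale :: "'k::field \<Rightarrow> 'v::ab_group_add \<Rightarrow> 'v"
    and bracket :: "'v \<Rightarrow> 'v \<Rightarrow> 'v" +
  fixes mult :: "'v \<Rightarrow> 'v \<Rightarrow> 'v"
  assumes linear_mult_right: "Vector_Spaces.linear scale scale (\<lambda>y. mult x y)"
    and linear_mult_left: "Vector_Spaces.linear scale scale (\<lambda>x. mult x y)"
    and mult_commute: "mult x y = mult y x"
    and mult_bracket_left: "mult (bracket x y) z = mult x (mult y z) - mult y (mult x z)"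
    and mult_bracket_right: "mult x (bracket y z) = bracket (mult x y) z + bracket y (mult x z)"

text \<open>
  The Lie algebra with basis \<open>e 1, \<dots>, e n\<close>; the values of \<open>e\<close> outside \<open>{1..n}\<close> are
  irrelevant. The Jacobi identity is not assumed: the sublocale declaration below derives it from
  the multiplication table.
\<close>

locale witt_algebra = vector_space scale
  for scale :: "complex \<Rightarrow> 'v::ab_group_add \<Rightarrow> 'v" +
  fixes bracket :: "'v \<Rightarrow> 'v \<Rightarrow> 'v" and n :: nat and e :: "nat \<Rightarrow> 'v"
  assumes bracket_right: "Vector_Spaces.linear scale scale (\<lambda>y. bracket x y)"
    and bracket_left: "Vector_Spaces.linear scale scale (\<lambda>x. bracket x y)"
    and bracket_alt: "bracket x x = 0"
    and inj_basis: "inj_on e {1..n}"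
    and independent_basis: "independent (e ` {1..n})"
    and span_basis: "span (e ` {1..n}) = UNIV"
    and bracket_1: "\<lbrakk>2 \<le> j; j \<le> n - 1\<rbrakk> \<Longrightarrow> bracket (e 1) (e j) = e (j + 1)"
    and bracket_ij: "\<lbrakk>2 \<le> i; real i \<le> (real n - 1) / 2; i + 1 \<le> j; j \<le> n - i\<rbrakk> \<Longrightarrow>
      bracket (e i) (e j) =
        scale (6 * (of_nat j - of_nat i) /
               (of_nat j * (of_nat j - 1) * of_nat ((j + i - 2) choose (i - 2)))) (e (i + j))"
    and bracket_zero: "\<lbrakk>1 \<le> i; i < j; j \<le> n; \<not> (i = 1 \<and> j \<le> n - 1);
      \<not> (2 \<le> i \<and> real i \<le> (real n - 1) / 2 \<and> j \<le> n - i)\<rbrakk> \<Longrightarrow> bracket (e i) (e j) = 0"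
begin

lemma bracket_simps:
  "bracket (x + y) z = bracket x z + bracket y z"
  "bracket x (y + z) = bracket x y + bracket x z"
  "bracket (scale c x) y = scale c (bracket x y)"
  "bracket x (scale c y) = scale c (bracket x y)"
  "bracket 0 y = 0" "bracket x 0 = 0"
proof -
  have l: "module_hom scale scale (\<lambda>x. bracket x y)"
    and r: "module_hom scale scale (\<lambda>y. bracket x y)" for x y
    using bracket_left bracket_right by (simp_all add: module_hom_iff_linear)
  show
    "bracket (x + y) z = bracket x z + bracket y z"
    "bracket x (y + z) = bracket x y + bracket x z"
    "bracket (scale c x) y = scale c (bracket x y)"
    "bracket x (scale c y) = scale c (bracket x y)"
    "bracket 0 y = 0" "bracket x 0 = 0"
    by (fact module_hom.add[OF l] module_hom.add[OF r] module_hom.scale[OF l]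
        module_hom.scale[OF r] module_hom.zero[OF l] module_hom.zero[OF r])+
qed

lemma bracket_anti: "bracket y x = - bracket x y"
proof -
  have "bracket (x + y) (x + y) = 0"
    by (rule bracket_alt)
  then have "bracket y x + bracket x y = 0"
    using bracket_alt[of x] bracket_alt[of y] by (simp add: bracket_simps add.commute)
  then show ?thesis
    by (simp add: eq_neg_iff_add_eq_0)
qed

text \<open>
  In the rescaled basis \<open>L k\<close> the bracket is that of the Witt algebra,
  \<open>[L i, L j] = (j - i) L (i + j)\<close>, truncated above \<open>n\<close>.
\<close>

definition witt_coeff :: "nat \<Rightarrow> complex" where
  "witt_coeff k = (if k = 1 then 1 else 6 * fact (k - 2))"

definition L :: "nat \<Rightarrow> 'v" where
  "L k = (if 1 \<le> k \<and> k \<le> n then scale (inverse (witt_coeff k)) (e k) else 0)"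

lemma witt_coeff_nonzero: "witt_coeff k \<noteq> 0"
  by (simp add: witt_coeff_def)

lemma bracket_L_less:
  assumes "1 \<le> i" "i < j"
  shows "bracket (L i) (L j) = scale (of_nat j - of_nat i) (L (i + j))"
proof (cases "i + j \<le> n")
  case False
  have "bracket (e i) (e j) = 0" if "j \<le> n"
    using assms that False by (intro bracket_zero) auto
  then show ?thesis
    using assms False by (auto simp: L_def bracket_simps)
next
  case True
  show ?thesis
  proof (cases "i = 1")
    case i1: True
    then have e: "bracket (e i) (e j) = e (i + j)"
      using bracket_1[of j] assms True by simp
    obtain m where m: "j = Suc (Suc m)"
      by (rule that[of "j - 2"]) (use assms i1 in arith)
    have "(of_nat j - 1 :: complex) = of_nat (Suc m)"
      by (simp add: m)
    moreover have "(of_nat (Suc m) :: complex) \<noteq> 0"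
      by (simp del: of_nat_Suc)
    ultimately have "inverse (6 * fact m :: complex) =
        (of_nat j - 1) * inverse (6 * (of_nat (Suc m) * fact m))"
      by (simp add: field_simps del: of_nat_Suc)
    then have "inverse (witt_coeff j) = (of_nat j - of_nat i) * inverse (witt_coeff (i + j))"
      using m i1 by (simp add: witt_coeff_def)
    then show ?thesis
      using True i1 m e by (simp add: L_def bracket_simps witt_coeff_def del: of_nat_Suc)
  next
    case i2: False
    define c :: complex where "c = 6 * (of_nat j - of_nat i) /
      (of_nat j * (of_nat j - 1) * of_nat ((j + i - 2) choose (i - 2)))"
    have e: "bracket (e i) (e j) = scale c (e (i + j))"
      unfolding c_def using assms True i2 by (intro bracket_ij) auto
    have "j + i - 2 - (i - 2) = j" "i - 2 \<le> j + i - 2" "j + i - 2 = i + j - 2"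
      using assms i2 by arith+
    then have choose: "of_nat ((j + i - 2) choose (i - 2)) =
        (fact (i + j - 2) / (fact (i - 2) * fact j) :: complex)"
      using binomial_fact[of "i - 2" "j + i - 2", where 'a = complex] by simp
    obtain b where b: "j = Suc (Suc b)"
      by (rule that[of "j - 2"]) (use assms in arith)
    have fact_j: "(fact j :: complex) = of_nat j * (of_nat j - 1) * fact (j - 2)"
      by (simp add: b algebra_simps)
    have nz: "(of_nat j :: complex) \<noteq> 0" "(of_nat j :: complex) - 1 \<noteq> 0"
      using b of_nat_eq_iff[of j 1, where 'a = complex] by (auto simp del: of_nat_Suc of_nat_eq_iff)
    have field: "inverse (6 * A) * (inverse (6 * B) * (6 * d / (r * s * (C / (A * (r * s * B)))))) =
        d * inverse (6 * C)" if "A \<noteq> 0" "B \<noteq> 0" "C \<noteq> 0" "r \<noteq> 0" "s \<noteq> 0"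
      for d r s A B C :: complex
      using that by (simp add: divide_simps)
    have coeff: "inverse (6 * fact (i - 2)) * (inverse (6 * fact (j - 2)) * c) =
        (of_nat j - of_nat i) * inverse (6 * fact (i + j - 2))"
      unfolding c_def choose fact_j by (rule field) (use nz in auto)
    have "bracket (L i) (L j) = scale (inverse (witt_coeff i) * (inverse (witt_coeff j) * c)) (e (i + j))"
      using assms True by (simp add: L_def bracket_simps e)
    also have "\<dots> = scale (of_nat j - of_nat i) (L (i + j))"
      using assms True i2 coeff by (simp add: L_def witt_coeff_def del: inverse_mult_distrib)
    finally show ?thesis .
  qed
qed

lemma bracket_L:
  assumes "1 \<le> i" "1 \<le> j"
  shows "bracket (L i) (L j) = scale (of_nat j - of_nat i) (L (i + j))"
proof (cases i j rule: linorder_cases)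
  case greater
  have "bracket (L i) (L j) = - scale (of_nat i - of_nat j) (L (i + j))"
    using bracket_L_less[of j i] bracket_anti[of "L i" "L j"] assms greater
    by (simp only: add.commute[of j i] minus_minus)
  also have "\<dots> = scale (of_nat j - of_nat i) (L (i + j))"
    by (metis minus_diff_eq scale_minus_left)
  finally show ?thesis .
qed (use assms bracket_L_less in \<open>auto simp: bracket_alt\<close>)

lemma span_L: "span (L ` {1..n}) = UNIV"
proof -
  have "e k \<in> span (L ` {1..n})" if "k \<in> {1..n}" for k
  proof -
    have "e k = scale (witt_coeff k) (L k)"
      using that witt_coeff_nonzero by (simp add: L_def)
    then show ?thesis
      using that by (metis imageI span_base span_scale)
  qed
  then have "span (e ` {1..n}) \<subseteq> span (L ` {1..n})"
    by (intro span_minimal) auto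
  then show ?thesis
    using span_basis by auto
qed

lemma jacobi_L:
  assumes "1 \<le> i" "1 \<le> j" "1 \<le> k"
  shows "bracket (L i) (bracket (L j) (L k)) + bracket (L j) (bracket (L k) (L i)) +
    bracket (L k) (bracket (L i) (L j)) = 0"
proof -
  have "bracket (L i) (bracket (L j) (L k)) + bracket (L j) (bracket (L k) (L i)) +
      bracket (L k) (bracket (L i) (L j)) =
    scale ((of_nat k - of_nat j) * (of_nat (j + k) - of_nat i) +
           (of_nat i - of_nat k) * (of_nat (k + i) - of_nat j) +
           (of_nat j - of_nat i) * (of_nat (i + j) - of_nat k)) (L (i + j + k))"
    using assms by (simp add: bracket_L bracket_simps scale_left_distrib add_ac)
  also have "(of_nat k - of_nat j) * (of_nat (j + k) - of_nat i) +
      (of_nat i - of_nat k) * (of_nat (k + i) - of_nat j) +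
      (of_nat j - of_nat i) * (of_nat (i + j) - of_nat k) = (0 :: complex)"
    by (simp add: algebra_simps)
  finally show ?thesis
    by simp
qed

lemma jacobi_witt:
  "bracket x (bracket y z) + bracket y (bracket z x) + bracket z (bracket x y) = 0"
proof -
  define J where
    "J x y z = bracket x (bracket y z) + bracket y (bracket z x) + bracket z (bracket x y)" for x y z
  have J: "J 0 y z = 0" "J (u + v) y z = J u y z + J v y z" "J (scale c u) y z = scale c (J u y z)"
    for c u v y z
    by (simp_all add: J_def bracket_simps scale_right_distrib add_ac)
  have rotate: "J x y z = J y z x" for x y z
    by (simp add: J_def add_ac)
  have extend: "J x y z = 0" if "\<And>i. 1 \<le> i \<Longrightarrow> J (L i) y z = 0" for x y z
  proof -
    have "x \<in> span (L ` {1..n})"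
      using span_L by blast
    then show ?thesis
      by (induction rule: span_induct_alt) (use that J in auto)
  qed
  have "J (L i) (L j) (L k) = 0" if "1 \<le> i" "1 \<le> j" "1 \<le> k" for i j k
    unfolding J_def using that by (rule jacobi_L)
  then have "J x (L j) (L k) = 0" if "1 \<le> j" "1 \<le> k" for x j k
    by (rule extend) (use that in auto)
  then have "J (L j) (L k) x = 0" if "1 \<le> j" "1 \<le> k" for x j k
    using that by (subst rotate[symmetric]) auto
  then have "J y (L k) x = 0" if "1 \<le> k" for x y k
    by (rule extend) (use that in auto)
  then have "J (L k) x y = 0" if "1 \<le> k" for x y k
    using that by (subst rotate[symmetric]) auto
  then have "J x y z = 0"
    by (rule extend)
  then show ?thesis
    by (simp add: J_def)
qed

end

sublocale witt_algebra \<subseteq> lie_algebra scale bracket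
  by unfold_locales (simp_all add: bracket_simps bracket_alt jacobi_witt)

end

(*
  In the Witt basis L the product splits into homogeneous components: m i j d is the coefficient of
  L (i + j + d) in the product of L i and L j. Commutativity and the derivation identity are linear
  and hold in each degree separately; as L 1 and L 2 generate the algebra, the component of degree d
  is determined by m 1 1 d, m 1 2 d and m 2 2 d. For d <= 0 evaluating the derivations on L 3, L 4
  and L 5 in all possible ways forces these three numbers to vanish; only d = 0, -1, -2, -3 need
  computation. If d >= 1 is the lowest remaining degree, the quadratic identity says that products
  with commutators vanish in degree d, which kills the component as long as d <= n - 5. For
  d = n - 4 it leaves one linear relation between m 1 1 d and m 1 2 d.
*)

theory Submission
  imports Defs
begin

section \<open>Coordinates in the Witt basis\<close>

context witt_algebra
begin

text \<open>\<open>representation\<close> refers to the basis \<open>e\<close>; the factor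
  \<open>witt_coeff\<close> turns its values into coordinates along \<open>L\<close>. Integer
  indices with default value 0 allow components of negative degree.\<close>

definition coord :: "int \<Rightarrow> 'v \<Rightarrow> complex" where
  "coord k x = (if 1 \<le> k \<and> k \<le> int n
     then witt_coeff (nat k) * representation (e ` {1..n}) x (e (nat k)) else 0)"

lemma coord_outside: "\<not> (1 \<le> k \<and> k \<le> int n) \<Longrightarrow> coord k x = 0"
  by (auto simp: coord_def)

lemma coord_linear:
  "coord k (x + y) = coord k x + coord k y"
  "coord k (x - y) = coord k x - coord k y"
  "coord k (scale c x) = c * coord k x"
  "coord k 0 = 0"
  using independent_basis span_basis
  by (simp_all add: coord_def representation_add representation_diff representation_scale
      representation_zero algebra_simps)

lemma coord_L: "coord k (L i) = (if k = int i \<and> 1 \<le> i \<and> i \<le> n then 1 else 0)"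
proof (cases "1 \<le> k \<and> k \<le> int n \<and> 1 \<le> i \<and> i \<le> n")
  case True
  then have "nat k \<in> {1..n}" "i \<in> {1..n}"
    by auto
  then have "representation (e ` {1..n}) (e i) (e (nat k)) = (if nat k = i then 1 else 0)"
    using representation_basis[OF independent_basis, of "e i"] inj_basis
    by (auto dest: inj_onD)
  then show ?thesis
    using True independent_basis span_basis witt_coeff_nonzero
    by (auto simp: coord_def L_def representation_scale)
next
  case False
  then show ?thesis
    by (auto simp: coord_outside coord_linear L_def)
qed

lemma sum_coord: "(\<Sum>k = 1..n. scale (coord (int k) x) (L k)) = x"
proof -
  have "(\<Sum>k = 1..n. scale (coord (int k) x) (L k)) =
      (\<Sum>k = 1..n. scale (representation (e ` {1..n}) x (e k)) (e k))"
    using witt_coeff_nonzero by (intro sum.cong) (auto simp: coord_def L_def)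
  also have "\<dots> = (\<Sum>b\<in>e ` {1..n}. scale (representation (e ` {1..n}) x b) b)"
    by (subst sum.reindex[OF inj_basis]) simp
  also have "\<dots> = x"
    using independent_basis span_basis by (intro sum_representation_eq) auto
  finally show ?thesis .
qed

lemma coord_eqI:
  assumes "\<And>k. 1 \<le> k \<Longrightarrow> k \<le> int n \<Longrightarrow> coord k x = coord k y"
  shows "x = y"
proof -
  have "(\<Sum>k = 1..n. scale (coord (int k) x) (L k)) = (\<Sum>k = 1..n. scale (coord (int k) y) (L k))"
    using assms by (intro sum.cong) auto
  then show ?thesis
    by (simp only: sum_coord)
qed

text \<open>With multiplication by \<open>L p\<close> as \<open>f\<close>, this reduces an iterated
  product to the components \<open>m\<close>.\<close>

lemma linear_expand:
  assumes "Vector_Spaces.linear scale scale f"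
  shows "coord k (f x) = (\<Sum>s = 1..n. coord (int s) x * coord k (f (L s)))"
proof -
  interpret f: Vector_Spaces.linear scale scale f
    by (fact assms)
  have coord_sum: "coord k (sum g A) = (\<Sum>s\<in>A. coord k (g s))" for g and A :: "nat set"
    by (induction A rule: infinite_finite_induct) (simp_all add: coord_linear)
  have "f x = f (\<Sum>s = 1..n. scale (coord (int s) x) (L s))"
    by (simp only: sum_coord)
  then show ?thesis
    by (simp add: f.sum f.scale coord_sum coord_linear)
qed

text \<open>Above \<open>n\<close> the equation fails: the left-hand side is truncated, \<open>coord (k - j)\<close> need not be.\<close>

lemma coord_bracket:
  assumes "1 \<le> j" "k \<le> int n"
  shows "coord k (bracket (L j) x) = (of_int k - 2 * of_nat j) * coord (k - int j) x"
proof -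
  have "x \<in> span (L ` {1..n})"
    using span_L by blast
  then show ?thesis
  proof (induction rule: span_induct_alt)
    case base
    then show ?case
      by (simp add: bracket_simps coord_linear)
  next
    case (step c b y)
    then obtain s where "b = L s" "1 \<le> s" "s \<le> n"
      by auto
    then have "coord k (bracket (L j) b) = (of_int k - 2 * of_nat j) * coord (k - int j) b"
      using assms by (auto simp: bracket_L coord_linear coord_L diff_eq_eq)
    with step show ?case
      by (simp add: bracket_simps coord_linear distrib_left mult.left_commute)
  qed
qed

end

section \<open>Homogeneous components of the product\<close>

locale witt_cpa = witt_algebra scale bracket n e + cpa_structure scale bracket mult
  for scale :: "complex \<Rightarrow> 'v::ab_group_add \<Rightarrow> 'v"
    and bracket mult :: "'v \<Rightarrow> 'v \<Rightarrow> 'v"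
    and n :: nat
    and e :: "nat \<Rightarrow> 'v" +
  assumes n_ge_7: "n \<ge> 7"
begin

definition m :: "nat \<Rightarrow> nat \<Rightarrow> int \<Rightarrow> complex" where
  "m i j d = coord (int i + int j + d) (mult (L i) (L j))"

lemma m_commute: "m i j d = m j i d"
  by (simp add: m_def mult_commute add_ac)

lemma m_outside: "\<not> (1 \<le> int i + int j + d \<and> int i + int j + d \<le> int n) \<Longrightarrow> m i j d = 0"
  unfolding m_def by (rule coord_outside)

lemma mult_scale: "mult (scale a x) (scale b y) = scale (a * b) (mult x y)"
proof -
  interpret l: Vector_Spaces.linear scale scale "\<lambda>x. mult x y" for y
    by (rule linear_mult_left)
  interpret r: Vector_Spaces.linear scale scale "\<lambda>y. mult x y" for x
    by (rule linear_mult_right)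
  show ?thesis
    by (simp add: l.scale r.scale)
qed

lemma m_derivation:
  assumes "1 \<le> j" "1 \<le> k" "l = j + k" "int i + int l + d \<le> int n"
  shows "(of_nat k - of_nat j) * m i l d =
    (of_nat i + of_nat k + of_int d - of_nat j) * m i k d -
    (of_nat i + of_nat j + of_int d - of_nat k) * m i j d"
proof -
  let ?c = "coord (int i + int j + int k + d)"
  have "mult (L i) (bracket (L j) (L k)) =
      bracket (L j) (mult (L i) (L k)) - bracket (L k) (mult (L i) (L j))"
    using mult_bracket_right[of "L i" "L j" "L k"] bracket_anti[of "L k" "mult (L i) (L j)"]
    by simp
  moreover have "mult (L i) (bracket (L j) (L k)) =
      scale (of_nat k - of_nat j) (mult (L i) (L (j + k)))"
    using mult_scale[of 1 "L i"] assms by (simp add: bracket_L)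
  ultimately have "?c (scale (of_nat k - of_nat j) (mult (L i) (L (j + k)))) =
      ?c (bracket (L j) (mult (L i) (L k)) - bracket (L k) (mult (L i) (L j)))"
    by simp
  then show ?thesis
    using assms by (simp add: coord_linear coord_bracket m_def algebra_simps)
qed

text \<open>\<open>L (j + 1)\<close> is a multiple of \<open>[L 1, L j]\<close>, so the derivation
  identity propagates vanishing; the factor \<open>j - 1\<close> is zero at \<open>j = 1\<close>,
  hence two starting values.\<close>

lemma m_row_zero:
  assumes "m i 1 d = 0" "m i 2 d = 0" "1 \<le> j"
  shows "m i j d = 0"
  using \<open>1 \<le> j\<close>
proof (induction j rule: nat_induct_at_least)
  case base
  show ?case
    by (fact assms)
next
  case (Suc j)
  show ?case
  proof (cases "j = 1 \<or> \<not> int i + int (Suc j) + d \<le> int n")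
    case True
    then show ?thesis
      using assms(2) by (auto simp: m_outside numeral_2_eq_2)
  next
    case False
    then have "(of_nat j - 1) * m i (Suc j) d = 0"
      using m_derivation[of 1 j "Suc j" i d] Suc assms by simp
    moreover have "(of_nat j :: complex) \<noteq> 1"
      using False of_nat_eq_iff[of j 1, where 'a = complex] by simp
    ultimately show ?thesis
      by simp
  qed
qed

lemma m_zero:
  assumes "m 1 1 d = 0" "m 1 2 d = 0" "m 2 2 d = 0" "1 \<le> i" "1 \<le> j"
  shows "m i j d = 0"
proof -
  have "m 1 k d = 0" "m 2 k d = 0" if "1 \<le> k" for k
    using assms that m_row_zero m_commute[of 2 1 d] by auto
  then show ?thesis
    using assms m_row_zero[of i d j] m_commute[of i] by auto
qed

section \<open>Degrees up to 0\<close>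

lemma m_nonpos_degree:
  assumes "d \<le> 0" "1 \<le> i" "1 \<le> j"
  shows "m i j d = 0"
proof -
  note der = m_derivation[where d = d]
  \<comment> \<open>The system is overdetermined: \<open>m 3 4 d\<close> is computed in row 3 and in
    row 4, \<open>m 1 5 d\<close> and \<open>m 2 5 d\<close> from both \<open>[L 1, L 4]\<close> and
    \<open>[L 2, L 3]\<close>. All indices are at most \<open>7 + d\<close>, hence at most
    \<open>n\<close>.\<close>
  have rel:
    "m 1 3 d = (2 + of_int d) * m 1 2 d - of_int d * m 1 1 d"
    "m 2 3 d = (3 + of_int d) * m 2 2 d - (1 + of_int d) * m 1 2 d"
    "m 3 3 d = (4 + of_int d) * m 2 3 d - (2 + of_int d) * m 1 3 d"
    "2 * m 1 4 d = (3 + of_int d) * m 1 3 d - (of_int d - 1) * m 1 1 d"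
    "2 * m 2 4 d = (4 + of_int d) * m 2 3 d - of_int d * m 1 2 d"
    "2 * m 3 4 d = (5 + of_int d) * m 3 3 d - (1 + of_int d) * m 1 3 d"
    "m 3 4 d = (5 + of_int d) * m 2 4 d - (3 + of_int d) * m 1 4 d"
    "3 * m 1 5 d = (4 + of_int d) * m 1 4 d - (of_int d - 2) * m 1 1 d"
    "m 1 5 d = (2 + of_int d) * m 1 3 d - of_int d * m 1 2 d"
    "3 * m 2 5 d = (5 + of_int d) * m 2 4 d - (of_int d - 1) * m 1 2 d"
    "m 2 5 d = (3 + of_int d) * m 2 3 d - (1 + of_int d) * m 2 2 d"
    using der[of 1 2 3 1] der[of 1 2 3 2] der[of 1 2 3 3] der[of 1 3 4 1] der[of 1 3 4 2] der[of 1 3 4 3]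
      der[of 1 2 3 4] der[of 1 4 5 1] der[of 2 3 5 1] der[of 1 4 5 2] der[of 2 3 5 2]
      m_commute[of 2 1] m_commute[of 3 1] m_commute[of 3 2] m_commute[of 4 1] m_commute[of 4 2]
      m_commute[of 4 3] assms n_ge_7
    by (simp_all add: algebra_simps)
  have "d = 0 \<or> d = -1 \<or> d = -2 \<or> d = -3 \<or> d \<le> -4"
    using assms by arith
  then have "m 1 1 d = 0 \<and> m 1 2 d = 0 \<and> m 2 2 d = 0"
  proof (elim disjE)
    assume "d = 0"
    then show ?thesis
      \<comment> \<open>Real and imaginary parts give linear systems over an ordered field, within
        reach of linear arithmetic.\<close>
      using rel by (simp add: complex_eq_iff)
  next
    assume d: "d = -1"
    \<comment> \<open>The relations above leave \<open>m 2 2 d\<close> free in this degree.\<close>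
    have "3 * m 3 5 d = 5 * m 3 4 d + m 1 3 d" "m 3 5 d = 3 * m 3 3 d - m 2 3 d"
      using der[of 1 4 5 3] der[of 2 3 5 3] m_commute[of 3 1] m_commute[of 3 2] n_ge_7 d by simp_all
    with d show ?thesis
      using rel by (simp add: complex_eq_iff)
  next
    assume d: "d = -2"
    then have "m 1 1 d = 0"
      by (intro m_outside) simp
    with d show ?thesis
      using rel by (simp add: complex_eq_iff)
  next
    assume d: "d = -3"
    then have "m 1 1 d = 0" "m 1 2 d = 0"
      by (auto intro!: m_outside)
    with d show ?thesis
      using rel by (simp add: complex_eq_iff)
  next
    assume "d \<le> -4"
    then show ?thesis
      by (auto intro!: m_outside)
  qed
  then show ?thesis
    using m_zero assms by blast
qed

section \<open>Positive degrees up to \<open>n - 5\<close>\<close>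

text \<open>
  If \<open>d \<ge> 1\<close> is the lowest degree of the product, then \<open>x \<cdot> (y \<cdot> z)\<close> has degree at least
  \<open>2 * d > d\<close>, so in degree \<open>d\<close> the first CPA identity reads \<open>[x, y] \<cdot> z = 0\<close>.
\<close>

lemma m_lowest_degree:
  assumes d: "1 \<le> d" and low: "\<And>i j d'. 1 \<le> i \<Longrightarrow> 1 \<le> j \<Longrightarrow> d' < d \<Longrightarrow> m i j d' = 0"
    and i: "3 \<le> i" and j: "1 \<le> j"
  shows "m i j d = 0"
proof -
  have zero: "coord (int p + int q + int j + d) (mult (L p) (mult (L q) (L j))) = 0"
    if "1 \<le> p" "1 \<le> q" for p q
  proof -
    \<comment> \<open>The degrees of the two factors add up to \<open>d\<close>: either the first is
      below \<open>d\<close>, or the second is at most 0 and so below \<open>d\<close>.\<close>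
    have "coord (int s) (mult (L q) (L j)) *
        coord (int p + int q + int j + d) (mult (L p) (L s)) = 0" if "1 \<le> s" for s
      using low[of q j "int s - int q - int j"] low[of p s "int q + int j + d - int s"]
        that \<open>1 \<le> p\<close> \<open>1 \<le> q\<close> j d
      by (cases "int s < int q + int j + d") (simp_all add: m_def add_ac)
    then show ?thesis
      by (subst linear_expand[OF linear_mult_right]) (auto intro!: sum.neutral)
  qed
  \<comment> \<open>\<open>[L 1, L p]\<close> is \<open>i - 2\<close> times \<open>L i\<close>, and
    \<open>i - 2\<close> is nonzero.\<close>
  define p where "p = i - 1"
  have p: "i = Suc p" "2 \<le> p"
    using i by (auto simp: p_def)
  have "mult (bracket (L 1) (L p)) (L j) = scale (of_nat p - 1) (mult (L i) (L j))"
    using mult_scale[where b = 1 and y = "L j"] p by (simp add: bracket_L)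
  then have "(of_nat p - 1) * m i j d = 0"
    using mult_bracket_left[of "L 1" "L p" "L j"] zero[of 1 p] zero[of p 1] p
    by (simp add: m_def coord_linear add_ac flip: coord_linear(3))
  moreover have "(of_nat p :: complex) \<noteq> 1"
    using p of_nat_eq_iff[of p 1, where 'a = complex] by simp
  ultimately show ?thesis
    by simp
qed

text \<open>By strong induction \<open>m_lowest_degree\<close> applies in degree \<open>d\<close>.
  The derivation relations then constrain the three remaining components; they reach index
  \<open>5 + d\<close>, whence the bound on \<open>d\<close>.\<close>

lemma m_low_degree:
  assumes "d \<le> int n - 5" "1 \<le> i" "1 \<le> j"
  shows "m i j d = 0"
  using assms
proof (induction "nat d" arbitrary: d i j rule: less_induct)
  case less
  show ?case
  proof (cases "d \<le> 0")
    case True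
    then show ?thesis
      using m_nonpos_degree less by blast
  next
    case False
    have low: "m i j d' = 0" if "1 \<le> i" "1 \<le> j" "d' < d" for i j d'
      using less.hyps[of d'] less.prems that False by auto
    have three: "m i 3 d = 0" "m i 4 d = 0" "m i 5 d = 0" if "1 \<le> i" for i
      using m_lowest_degree[OF _ low] that False m_commute[of i] by simp_all
    note der = m_derivation[where d = d]
    have AB: "(2 + of_int d) * m 1 2 d = of_int d * m 1 1 d"
      and BC: "(3 + of_int d) * m 2 2 d = (1 + of_int d) * m 1 2 d"
      and A: "(of_int d - 1) * m 1 1 d = 0"
      using der[of 1 2 3 1] der[of 1 2 3 2] der[of 1 3 4 1] three[of 1] three[of 2]
        m_commute[of 2 1] less.prems
      by (simp_all add: algebra_simps)
    have nz: "2 + of_int d \<noteq> (0 :: complex)" "3 + of_int d \<noteq> (0 :: complex)"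
      using False of_int_eq_iff[of "2 + d" 0, where 'a = complex]
        of_int_eq_iff[of "3 + d" 0, where 'a = complex] by (auto simp del: of_int_eq_iff)
    have A0: "m 1 1 d = 0"
    proof (cases "d = 1")
      case True
      \<comment> \<open>Here \<open>A\<close> is void. Instead \<open>[L 2, L 3] = L 5\<close> gives
        \<open>m 1 2 d = 0\<close>, at index 7, and \<open>AB\<close> does the rest.\<close>
      then show ?thesis
        using der[of 2 3 5 1] three[of 1] AB n_ge_7 by simp
    next
      case False
      then show ?thesis
        using A by simp
    qed
    with AB BC nz have "m 1 2 d = 0" "m 2 2 d = 0"
      by auto
    with A0 show ?thesis
      using m_zero less.prems by blast
  qed
qed

section \<open>The remaining top degrees\<close>

lemma coord_mult:
  "coord k (mult (L i) (L j)) = m i j (k - int i - int j)"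
  by (simp add: m_def)

text \<open>As \<open>i + j\<close> is at least 4, only degrees up to \<open>n - 4\<close> fit below
  \<open>n\<close>. Degree \<open>n - 4\<close> is the lowest one left, so products with the
  commutator \<open>L j\<close> vanish there.\<close>

lemma mult_L_L_eq_0:
  assumes "1 \<le> i" "i \<le> j" "(i, j) \<notin> {(1, 1), (1, 2), (2, 2)}"
  shows "mult (L i) (L j) = 0"
proof (rule coord_eqI)
  fix k assume k: "1 \<le> k" "k \<le> int n"
  have "3 \<le> j"
    using assms by auto
  have "m i j (k - int i - int j) = 0"
  proof (cases "k - int i - int j \<le> int n - 5")
    case True
    then show ?thesis
      using m_low_degree assms by simp
  next
    case False
    then have "k - int i - int j = int n - 4"
      using k \<open>3 \<le> j\<close> assms by linarith
    moreover have "m j i (int n - 4) = 0"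
      using n_ge_7 \<open>3 \<le> j\<close> assms by (intro m_lowest_degree[OF _ m_low_degree]) auto
    ultimately show ?thesis
      by (simp add: m_commute)
  qed
  then show "coord k (mult (L i) (L j)) = coord k 0"
    by (simp add: coord_mult coord_linear)
qed

text \<open>The derivation identity for \<open>L 3 = [L 1, L 2]\<close> is still available here,
  since its index is exactly \<open>n\<close>.\<close>

lemma m_1_2_top: "(of_nat n - 2) * m 1 2 (int n - 4) = (of_nat n - 4) * m 1 1 (int n - 4)"
proof -
  have "m 1 3 (int n - 4) = 0"
    using mult_L_L_eq_0[of 1 3] by (simp add: m_def coord_linear)
  then show ?thesis
    using m_derivation[of 1 2 3 1 "int n - 4"] by (simp add: algebra_simps)
qed

lemma mult_L_low:
  "mult (L 1) (L 1) = scale (m 1 1 (int n - 4)) (L (n - 2)) +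
    scale (m 1 1 (int n - 3)) (L (n - 1)) + scale (m 1 1 (int n - 2)) (L n)"
  "mult (L 1) (L 2) = scale (m 1 2 (int n - 4)) (L (n - 1)) + scale (m 1 2 (int n - 3)) (L n)"
  "mult (L 2) (L 2) = scale (m 2 2 (int n - 4)) (L n)"
proof -
  have n: "int (n - 2) = int n - 2" "int (n - 1) = int n - 1" "2 \<le> n"
    using n_ge_7 by auto
  show "mult (L 1) (L 1) = scale (m 1 1 (int n - 4)) (L (n - 2)) +
      scale (m 1 1 (int n - 3)) (L (n - 1)) + scale (m 1 1 (int n - 2)) (L n)"
  proof (rule coord_eqI)
    fix k assume "1 \<le> k" "k \<le> int n"
    then consider "k \<le> int n - 3" | "k = int n - 2" | "k = int n - 1" | "k = int n"
      by linarith
    then show "coord k (mult (L 1) (L 1)) = coord k (scale (m 1 1 (int n - 4)) (L (n - 2)) +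
        scale (m 1 1 (int n - 3)) (L (n - 1)) + scale (m 1 1 (int n - 2)) (L n))"
      by cases (use n_ge_7 n in \<open>simp_all add: coord_mult coord_linear coord_L m_low_degree\<close>)
  qed
  show "mult (L 1) (L 2) =
      scale (m 1 2 (int n - 4)) (L (n - 1)) + scale (m 1 2 (int n - 3)) (L n)"
  proof (rule coord_eqI)
    fix k assume "1 \<le> k" "k \<le> int n"
    then consider "k \<le> int n - 2" | "k = int n - 1" | "k = int n"
      by linarith
    then show "coord k (mult (L 1) (L 2)) =
        coord k (scale (m 1 2 (int n - 4)) (L (n - 1)) + scale (m 1 2 (int n - 3)) (L n))"
      by cases (use n_ge_7 n in \<open>simp_all add: coord_mult coord_linear coord_L m_low_degree\<close>)
  qed
  show "mult (L 2) (L 2) = scale (m 2 2 (int n - 4)) (L n)"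
  proof (rule coord_eqI)
    fix k assume "1 \<le> k" "k \<le> int n"
    then consider "k \<le> int n - 1" | "k = int n"
      by linarith
    then show "coord k (mult (L 2) (L 2)) = coord k (scale (m 2 2 (int n - 4)) (L n))"
      by cases (use n_ge_7 n in \<open>simp_all add: coord_mult coord_linear coord_L m_low_degree\<close>)
  qed
qed

section \<open>Return to the basis \<open>e\<close>\<close>

lemma e_eq_L: "1 \<le> k \<Longrightarrow> k \<le> n \<Longrightarrow> e k = scale (witt_coeff k) (L k)"
  using witt_coeff_nonzero by (simp add: L_def)

lemma mult_e: "1 \<le> i \<Longrightarrow> i \<le> n \<Longrightarrow> 1 \<le> j \<Longrightarrow> j \<le> n \<Longrightarrow>
    mult (e i) (e j) = scale (witt_coeff i * witt_coeff j) (mult (L i) (L j))"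
  by (simp add: e_eq_L mult_scale)

end

theorem proposition3p15:
  fixes n :: nat
    and scale :: "complex \<Rightarrow> 'v::ab_group_add \<Rightarrow> 'v"
    and bracket mult :: "'v \<Rightarrow> 'v \<Rightarrow> 'v"
    and e :: "nat \<Rightarrow> 'v"
  assumes "n \<ge> 7"
    and "witt_algebra scale bracket n e"
    and "cpa_structure scale bracket mult"
  shows "\<exists>\<alpha> \<beta> \<gamma> \<delta> \<epsilon> :: complex.
    mult (e 1) (e 1) = scale \<alpha> (e (n - 2)) + scale \<beta> (e (n - 1)) + scale \<gamma> (e n) \<and>
    mult (e 1) (e 2) =
      scale (6 * (of_nat n - 4) / ((of_nat n - 2) * (of_nat n - 3)) * \<alpha>) (e (n - 1)) +
      scale \<delta> (e n) \<and>
    mult (e 2) (e 2) = scale \<epsilon> (e n) \<and>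
    (\<forall>i j. 1 \<le> i \<and> i \<le> j \<and> j \<le> n \<and> (i, j) \<notin> {(1, 1), (1, 2), (2, 2)} \<longrightarrow>
      mult (e i) (e j) = 0)"
proof -
  interpret witt_cpa scale bracket mult n e
    using assms by (intro witt_cpa.intro witt_cpa_axioms.intro)
  obtain p where p: "n = p + 4" "3 \<le> p"
    by (rule that[of "n - 4"]) (use n_ge_7 in auto)
  define w where "w k = inverse (witt_coeff k)" for k
  have L: "L n = scale (w n) (e n)" "L (n - 1) = scale (w (n - 1)) (e (n - 1))"
    "L (n - 2) = scale (w (n - 2)) (e (n - 2))"
    using n_ge_7 by (auto simp: L_def w_def)
  \<comment> \<open>Source of \<open>n - 3\<close> in the denominator: consecutive factorials. The
    quotient of \<open>n - 4\<close> by \<open>n - 2\<close> comes from \<open>m_1_2_top\<close>,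
    the 6 from \<open>witt_coeff 2\<close>.\<close>
  have w: "w (n - 1) = w (n - 2) / (of_nat n - 3)"
    using p by (simp add: w_def witt_coeff_def field_simps)
  have "(of_nat n - 2 :: complex) \<noteq> 0"
    using p of_nat_eq_iff[of n 2, where 'a = complex] by (simp del: of_nat_eq_iff)
  then have m12: "m 1 2 (int n - 4) = (of_nat n - 4) / (of_nat n - 2) * m 1 1 (int n - 4)"
    using m_1_2_top by (simp add: field_simps)
  have w12: "witt_coeff 1 = 1" "witt_coeff 2 = 6"
    by (simp_all add: witt_coeff_def)
  show ?thesis
  proof (intro exI conjI allI impI)
    show "mult (e 1) (e 1) = scale (m 1 1 (int n - 4) * w (n - 2)) (e (n - 2)) +
        scale (m 1 1 (int n - 3) * w (n - 1)) (e (n - 1)) + scale (m 1 1 (int n - 2) * w n) (e n)"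
      using n_ge_7 by (simp add: mult_e w12 mult_L_low L del: One_nat_def)
    show "mult (e 1) (e 2) =
        scale (6 * (of_nat n - 4) / ((of_nat n - 2) * (of_nat n - 3)) *
          (m 1 1 (int n - 4) * w (n - 2))) (e (n - 1)) +
        scale (6 * m 1 2 (int n - 3) * w n) (e n)"
      using n_ge_7 by (simp add: mult_e w12 mult_L_low L w m12 scale_right_distrib mult_ac
          del: One_nat_def)
    show "mult (e 2) (e 2) = scale (36 * m 2 2 (int n - 4) * w n) (e n)"
      using n_ge_7 by (simp add: mult_e w12 mult_L_low L del: One_nat_def)
    show "mult (e i) (e j) = 0"
      if "1 \<le> i \<and> i \<le> j \<and> j \<le> n \<and> (i, j) \<notin> {(1, 1), (1, 2), (2, 2)}" for i j
      using that mult_e[of i j] mult_L_L_eq_0[of i j] by auto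
  qed
qed

end
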